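(* Let $p$ be a prime, and let $K=\{k_1,k_2,\ldots,k_r\}$ and $L=\{l_1,l_2,\ldots,l_s\}$ be two disjoint subsets of $\{0,1,\ldots,p-1\}$ (with $r=|K|\ge1$, $s=|L|$). Let $\mathcal{A}=\{A_1,\ldots,A_m\}$ be a family of distinct subsets of $[n]$ such that $|A_i|\pmod p\in K$ for every $i$ and $|A_i\cap A_j|\pmod p\in L$ for every $i\ne j$. If $n\ge 2s-2r+1$, then \[ |\mathcal{A}|\le \binom{n-1}{s}+\binom{n-1}{s-1}+\cdots+\binom{n-1}{s-2r+1}. \]
   Context: Binomial coefficients $\binom{a}{b}$ with $b<0$ are interpreted as $0$. *)

theory Defs
  imports "HOL-Computational_Algebra.Primes"
begin

definition ibinom :: "nat \<Rightarrow> int \<Rightarrow> nat" where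
  "ibinom a b = (if b < 0 then 0 else a choose (nat b))"

end

theory Submission
  imports Defs "HOL-Library.FuncSet"
begin

text \<open>
  Let \<open>v = n\<close> be a point of the ground set, \<open>V\<close> the set of the others, \<open>r = |K|\<close> and \<open>s = |L|\<close>. Consider multilinear
  polynomials modulo \<open>p\<close> in the indicator variables of \<open>V\<close>. To a member \<open>A\<close> of the family attach
  \<open>f\<^sub>A(X) = \<Prod>\<^bsub>l\<in>L\<^esub> (|X \<inter> A| + [v \<in> A] - l)\<close>, and to a set \<open>I\<close> of at most \<open>s - 2r\<close> points attach
  \<open>g\<^sub>I(X) = [I \<subseteq> X] \<Prod>\<^bsub>k\<in>K\<^esub> (|X| - k)(|X| - k + 1)\<close>. All have degree at most \<open>s\<close>. Every \<open>g\<^sub>I\<close> vanishes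
  at every \<open>C - {v}\<close> with \<open>C\<close> in the family. The matrix of values \<open>f\<^sub>A(C - {v})\<close> is block triangular with nonzero
  diagonal if the sets containing \<open>v\<close> come first. So the \<open>f\<^sub>A\<close> and \<open>g\<^sub>I\<close> together are
  independent as soon as the \<open>g\<^sub>I\<close> are, and counting dimensions gives the bound.

  The leading form of a combination of the \<open>g\<^sub>I\<close> of top degree \<open>a = |I|\<close> is obtained by
  multiplying its part of degree \<open>a\<close> by the \<open>2r\<close>-th power of the sum of the variables, where squares of variables
  are set to zero. This multiplication by an \<open>m\<close>-th power is injective modulo \<open>p\<close> in degree \<open>a\<close>
  whenever \<open>2a + m \<le> |V|\<close> and \<open>a + m < p\<close>; here \<open>n \<ge> 2s - 2r + 1\<close> enters.
\<close>

section \<open>Linear systems modulo a prime\<close>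

text \<open>Comparing the numbers \<open>p ^ card E\<close> and \<open>p ^ card B\<close> of vectors modulo \<open>p\<close> replaces linear algebra
  over the field with \<open>p\<close> elements.\<close>

lemma card_le_if_independent_mod:
  fixes u :: "'e \<Rightarrow> 'b \<Rightarrow> int" and p :: nat
  assumes "p > 1" "finite E" "finite B"
    and indep: "\<And>c e. (\<forall>b\<in>B. int p dvd (\<Sum>e\<in>E. c e * u e b)) \<Longrightarrow> e \<in> E \<Longrightarrow> int p dvd c e"
  shows "card E \<le> card B"
proof -
  let ?R = "{0..<int p}"
  define \<Phi> where "\<Phi> c = (\<lambda>b\<in>B. (\<Sum>e\<in>E. c e * u e b) mod int p)" for c
  have "inj_on \<Phi> (E \<rightarrow>\<^sub>E ?R)"
  proof (rule inj_onI)
    fix c d assume vectors: "c \<in> E \<rightarrow>\<^sub>E ?R" "d \<in> E \<rightarrow>\<^sub>E ?R" and same_image: "\<Phi> c = \<Phi> d"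
    have "int p dvd (\<Sum>e\<in>E. (c e - d e) * u e b)" if "b \<in> B" for b
      using fun_cong[OF same_image, of b] that
      by (simp add: \<Phi>_def mod_eq_dvd_iff left_diff_distrib sum_subtractf)
    then have "int p dvd c e - d e" if "e \<in> E" for e
      using indep[of "\<lambda>e. c e - d e"] that by blast
    then have "c e mod int p = d e mod int p" if "e \<in> E" for e
      using that by (simp add: mod_eq_dvd_iff)
    moreover have "c e \<in> ?R" "d e \<in> ?R" if "e \<in> E" for e
      using vectors that by auto
    ultimately have "c e = d e" if "e \<in> E" for e
      using that by fastforce
    then show "c = d" by (rule PiE_ext[OF vectors])
  qed
  moreover have "\<Phi> ` (E \<rightarrow>\<^sub>E ?R) \<subseteq> B \<rightarrow>\<^sub>E ?R"
    using \<open>p > 1\<close> by (auto simp: \<Phi>_def)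
  moreover have "finite (B \<rightarrow>\<^sub>E ?R)" using \<open>finite B\<close> by (intro finite_PiE) auto
  ultimately have "card (E \<rightarrow>\<^sub>E ?R) \<le> card (B \<rightarrow>\<^sub>E ?R)" by (rule card_inj_on_le)
  then have "p ^ card E \<le> p ^ card B" using assms(2,3) by (simp add: card_PiE)
  then show ?thesis using \<open>p > 1\<close> by simp
qed

lemma triangular_system_dvd:
  fixes M :: "'e \<Rightarrow> 'e \<Rightarrow> 'r::comm_ring_1" and rank :: "'e \<Rightarrow> nat"
  assumes "prime_elem q" "finite E"
    and off_diagonal: "\<And>i j. i \<in> E \<Longrightarrow> j \<in> E \<Longrightarrow> i \<noteq> j \<Longrightarrow> rank j \<le> rank i \<Longrightarrow> q dvd M i j"
    and diagonal: "\<And>j. j \<in> E \<Longrightarrow> \<not> q dvd M j j"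
    and solution: "\<And>j. j \<in> E \<Longrightarrow> q dvd (\<Sum>i\<in>E. x i * M i j)"
    and "j \<in> E"
  shows "q dvd x j"
  using \<open>j \<in> E\<close>
proof (induction j rule: measure_induct_rule[of rank])
  case (less j)
  have "q dvd x i * M i j" if "i \<in> E - {j}" for i
    using that less off_diagonal[of i j] by (cases "rank i < rank j") auto
  then have "q dvd (\<Sum>i\<in>E - {j}. x i * M i j)" by (rule dvd_sum)
  then have "q dvd x j * M j j"
    using solution[OF less.prems] less.prems \<open>finite E\<close>
    by (simp add: sum.remove[of E j] dvd_add_left_iff)
  then show ?case
    using \<open>prime_elem q\<close> diagonal[OF less.prems] by (simp add: prime_elem_dvd_mult_iff)
qed

section \<open>Multilinear polynomials\<close>

text \<open>A function \<open>c\<close> on sets stands for the multilinear polynomial with coefficient \<open>c J\<close> at the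
  monomial \<open>\<Prod>\<^bsub>i\<in>J\<^esub> x\<^sub>i\<close>. The operator \<open>mult_affine A t\<close> multiplies by \<open>(\<Sum>\<^bsub>i\<in>A\<^esub> x\<^sub>i) - t\<close> modulo
  \<open>x\<^sub>i\<^sup>2 = x\<^sub>i\<close>.\<close>

definition multilinear_eval :: "('a set \<Rightarrow> 'r::comm_ring_1) \<Rightarrow> 'a set \<Rightarrow> 'r" where
  "multilinear_eval c X = (\<Sum>J\<in>Pow X. c J)"

definition monomial :: "'a set \<Rightarrow> 'a set \<Rightarrow> 'r::comm_ring_1" where
  "monomial I J = of_bool (J = I)"

definition mult_affine :: "'a set \<Rightarrow> 'r::comm_ring_1 \<Rightarrow> ('a set \<Rightarrow> 'r) \<Rightarrow> 'a set \<Rightarrow> 'r" where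
  "mult_affine A t c J = (of_nat (card (J \<inter> A)) - t) * c J + (\<Sum>i\<in>J \<inter> A. c (J - {i}))"

abbreviation mult_affines :: "'a set \<Rightarrow> 'r::comm_ring_1 list \<Rightarrow> ('a set \<Rightarrow> 'r) \<Rightarrow> 'a set \<Rightarrow> 'r" where
  "mult_affines A ts \<equiv> fold (mult_affine A) ts"

lemma multilinear_eval_monomial:
  "finite X \<Longrightarrow> multilinear_eval (monomial I) X = of_bool (I \<subseteq> X)"
  by (simp add: multilinear_eval_def monomial_def of_bool_def)

lemma multilinear_eval_add:
  "multilinear_eval (\<lambda>J. c J + d J) X = multilinear_eval c X + multilinear_eval d X"
  by (simp add: multilinear_eval_def sum.distrib)

lemma multilinear_eval_sum:
  "multilinear_eval (\<lambda>J. \<Sum>e\<in>E. x e * u e J) X = (\<Sum>e\<in>E. x e * multilinear_eval (u e) X)"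
  unfolding multilinear_eval_def by (subst sum.swap) (simp add: sum_distrib_left)

lemma sum_Pow_remove_element:
  fixes c :: "'a set \<Rightarrow> 'r::comm_ring_1"
  assumes "finite X"
  shows "(\<Sum>J\<in>Pow X. \<Sum>i\<in>J \<inter> A. c (J - {i})) = (\<Sum>I\<in>Pow X. of_nat (card ((X - I) \<inter> A)) * c I)"
proof -
  have "(\<Sum>J\<in>Pow X. \<Sum>i\<in>J \<inter> A. c (J - {i})) = (\<Sum>(J,i)\<in>Sigma (Pow X) (\<lambda>J. J \<inter> A). c (J - {i}))"
    using assms by (subst sum.Sigma) (auto intro: finite_subset)
  also have "\<dots> = (\<Sum>(I,i)\<in>Sigma (Pow X) (\<lambda>I. (X - I) \<inter> A). c I)"
    by (rule sum.reindex_bij_witness[where i = "\<lambda>(I,i). (insert i I, i)" and j = "\<lambda>(J,i). (J - {i}, i)"])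
       auto
  also have "\<dots> = (\<Sum>I\<in>Pow X. \<Sum>i\<in>(X - I) \<inter> A. c I)"
    using assms by (subst sum.Sigma) auto
  finally show ?thesis by simp
qed

lemma multilinear_eval_mult_affine:
  assumes "finite X"
  shows "multilinear_eval (mult_affine A t c) X = (of_nat (card (X \<inter> A)) - t) * multilinear_eval c X"
proof -
  have card_split: "card (X \<inter> A) = card (J \<inter> A) + card ((X - J) \<inter> A)" if "J \<subseteq> X" for J
  proof -
    have "X \<inter> A \<inter> J = J \<inter> A" "X \<inter> A - J = (X - J) \<inter> A" using that by auto
    then show ?thesis using card_Int_Diff[of "X \<inter> A" J] assms by simp
  qed
  have "multilinear_eval (mult_affine A t c) X
      = (\<Sum>J\<in>Pow X. (of_nat (card (J \<inter> A)) - t) * c J + of_nat (card ((X - J) \<inter> A)) * c J)"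
    by (simp add: multilinear_eval_def mult_affine_def sum.distrib sum_Pow_remove_element[OF assms])
  also have "\<dots> = (\<Sum>J\<in>Pow X. (of_nat (card (X \<inter> A)) - t) * c J)"
    by (rule sum.cong[OF refl]) (simp add: card_split algebra_simps)
  finally show ?thesis by (simp add: multilinear_eval_def sum_distrib_left)
qed

lemma multilinear_eval_mult_affines:
  assumes "finite X"
  shows "multilinear_eval (mult_affines A ts c) X
    = (\<Prod>t\<leftarrow>ts. of_nat (card (X \<inter> A)) - t) * multilinear_eval c X"
  by (induction ts arbitrary: c) (simp_all add: multilinear_eval_mult_affine assms)

lemma mult_affine_sum:
  "mult_affine A t (\<lambda>J. \<Sum>e\<in>E. x e * u e J) = (\<lambda>J. \<Sum>e\<in>E. x e * mult_affine A t (u e) J)"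
proof
  fix J
  have "(\<Sum>i\<in>J \<inter> A. \<Sum>e\<in>E. x e * u e (J - {i})) = (\<Sum>e\<in>E. x e * (\<Sum>i\<in>J \<inter> A. u e (J - {i})))"
    by (subst sum.swap) (simp add: sum_distrib_left)
  then show "mult_affine A t (\<lambda>J. \<Sum>e\<in>E. x e * u e J) J = (\<Sum>e\<in>E. x e * mult_affine A t (u e) J)"
    by (simp add: mult_affine_def sum.distrib sum_distrib_left distrib_left mult.left_commute)
qed

lemma mult_affines_sum:
  "mult_affines A ts (\<lambda>J. \<Sum>e\<in>E. x e * u e J) = (\<lambda>J. \<Sum>e\<in>E. x e * mult_affines A ts (u e) J)"
  by (induction ts arbitrary: u) (simp_all add: mult_affine_sum)

section \<open>Degrees and leading forms modulo an element\<close>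

text \<open>Modulo \<open>q = 0\<close> these are the exact notions.\<close>

definition degree_less_mod :: "'r::comm_ring_1 \<Rightarrow> 'a set \<Rightarrow> nat \<Rightarrow> ('a set \<Rightarrow> 'r) \<Rightarrow> bool" where
  "degree_less_mod q V a c \<longleftrightarrow> (\<forall>J. J \<subseteq> V \<and> a \<le> card J \<longrightarrow> q dvd c J)"

definition layer_zero_mod :: "'r::comm_ring_1 \<Rightarrow> 'a set \<Rightarrow> nat \<Rightarrow> ('a set \<Rightarrow> 'r) \<Rightarrow> bool" where
  "layer_zero_mod q V a c \<longleftrightarrow> (\<forall>J. J \<subseteq> V \<and> card J = a \<longrightarrow> q dvd c J)"

lemma degree_less_modI:
  "(\<And>J. J \<subseteq> V \<Longrightarrow> a \<le> card J \<Longrightarrow> q dvd c J) \<Longrightarrow> degree_less_mod q V a c"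
  by (simp add: degree_less_mod_def)

lemma degree_less_modD: "degree_less_mod q V a c \<Longrightarrow> J \<subseteq> V \<Longrightarrow> a \<le> card J \<Longrightarrow> q dvd c J"
  by (simp add: degree_less_mod_def)

lemma layer_zero_modI:
  "(\<And>J. J \<subseteq> V \<Longrightarrow> card J = a \<Longrightarrow> q dvd c J) \<Longrightarrow> layer_zero_mod q V a c"
  by (simp add: layer_zero_mod_def)

lemma layer_zero_modD: "layer_zero_mod q V a c \<Longrightarrow> J \<subseteq> V \<Longrightarrow> card J = a \<Longrightarrow> q dvd c J"
  by (simp add: layer_zero_mod_def)

lemma layer_zero_mod_diff_trans:
  assumes "layer_zero_mod q V a (\<lambda>J. c J - d J)" "layer_zero_mod q V a (\<lambda>J. d J - e J)"
  shows "layer_zero_mod q V a (\<lambda>J. c J - e J)"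
proof (rule layer_zero_modI)
  fix J assume "J \<subseteq> V" "card J = a"
  then have "q dvd (c J - d J) + (d J - e J)"
    using assms by (intro dvd_add) (auto dest: layer_zero_modD)
  then show "q dvd c J - e J" by simp
qed

lemma degree_less_mod_drop_top:
  assumes "degree_less_mod q V (Suc a) c" "layer_zero_mod q V a c"
  shows "degree_less_mod q V a c"
  using assms by (auto simp: degree_less_mod_def layer_zero_mod_def le_eq_less_or_eq Suc_le_eq)

lemma degree_less_mod_monomial: "degree_less_mod q V (Suc (card I)) (monomial I)"
  by (auto simp: degree_less_mod_def monomial_def)

lemma degree_less_mod_mult_affine:
  assumes "finite V" "degree_less_mod q V a c"
  shows "degree_less_mod q V (Suc a) (mult_affine A t c)"
proof (rule degree_less_modI)
  fix J assume layer: "J \<subseteq> V" "Suc a \<le> card J"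
  then have "a \<le> card (J - {i})" if "i \<in> J" for i
    using that finite_subset[OF layer(1) \<open>finite V\<close>] by simp
  then show "q dvd mult_affine A t c J"
    unfolding mult_affine_def using layer
    by (intro dvd_add dvd_mult dvd_sum degree_less_modD[OF assms(2)]) auto
qed

lemma degree_less_mod_mult_affines:
  assumes "finite V" "degree_less_mod q V a c"
  shows "degree_less_mod q V (a + length ts) (mult_affines A ts c)"
  using assms(2)
proof (induction ts arbitrary: c a)
  case (Cons t ts)
  then show ?case
    using Cons.IH[of "Suc a" "mult_affine A t c"] degree_less_mod_mult_affine[OF assms(1) Cons.prems]
    by simp
qed simp

section \<open>The up operator of the Boolean lattice\<close>

text \<open>Multiplication by the sum of the variables modulo \<open>x\<^sub>i\<^sup>2 = 0\<close>.\<close>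

definition up_op :: "('a set \<Rightarrow> 'r::comm_ring_1) \<Rightarrow> 'a set \<Rightarrow> 'r" where
  "up_op c J = (\<Sum>i\<in>J. c (J - {i}))"

lemma up_op_diff: "up_op (\<lambda>J. c J - d J) = (\<lambda>J. up_op c J - up_op d J)"
  by (simp add: fun_eq_iff up_op_def sum_subtractf)

lemma up_op_scale_add: "up_op (\<lambda>J. x * c J + d J) = (\<lambda>J. x * up_op c J + up_op d J)"
  by (simp add: fun_eq_iff up_op_def sum.distrib sum_distrib_left)

lemma up_op_pow_diff:
  "(up_op ^^ m) (\<lambda>J. c J - d J) = (\<lambda>J. (up_op ^^ m) c J - (up_op ^^ m) d J)"
  by (induction m) (simp_all add: up_op_diff)

lemma layer_zero_mod_up_op:
  assumes "finite V" "layer_zero_mod q V a c"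
  shows "layer_zero_mod q V (Suc a) (up_op c)"
proof (rule layer_zero_modI)
  fix J assume layer: "J \<subseteq> V" "card J = Suc a"
  then have "finite J" using assms(1) finite_subset by blast
  then show "q dvd up_op c J"
    unfolding up_op_def using layer by (intro dvd_sum layer_zero_modD[OF assms(2)]) auto
qed

lemma layer_zero_mod_up_op_pow:
  assumes "finite V" "layer_zero_mod q V a c"
  shows "layer_zero_mod q V (a + m) ((up_op ^^ m) c)"
  by (induction m) (simp_all add: assms layer_zero_mod_up_op)

lemma up_op_pow_eq_0: "finite J \<Longrightarrow> card J < m \<Longrightarrow> (up_op ^^ m) c J = 0"
proof (induction m arbitrary: J)
  case (Suc m)
  have "card (J - {i}) < m" if "i \<in> J" for i
    using card_Diff1_less[of J i] Suc.prems that by linarith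
  then have "up_op ((up_op ^^ m) c) J = 0"
    unfolding up_op_def[of "(up_op ^^ m) c"] using Suc.prems(1)
    by (intro sum.neutral ballI Suc.IH) auto
  then show ?case by simp
qed simp

lemma layer_zero_mod_up_op_pow_Suc:
  assumes "finite V" and below: "\<And>b. a = Suc b \<Longrightarrow> layer_zero_mod q V b c"
  shows "layer_zero_mod q V (a + m) ((up_op ^^ Suc m) c)"
proof (cases a)
  case 0
  then show ?thesis
    using up_op_pow_eq_0[OF finite_subset[OF _ assms(1)], of _ "Suc m" c]
    by (simp add: layer_zero_mod_def del: funpow.simps)
next
  case (Suc b)
  then show ?thesis using layer_zero_mod_up_op_pow[OF assms(1) below[OF Suc], of "Suc m"] by simp
qed

lemma layer_zero_mod_mult_affine_diff_up_op:
  assumes "finite V" "degree_less_mod q V (Suc a) c"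
  shows "layer_zero_mod q V (Suc a) (\<lambda>J. mult_affine V t c J - up_op c J)"
proof (rule layer_zero_modI)
  fix J assume layer: "J \<subseteq> V" "card J = Suc a"
  then have "J \<inter> V = J" by auto
  then show "q dvd mult_affine V t c J - up_op c J"
    using degree_less_modD[OF assms(2), of J] layer by (simp add: mult_affine_def up_op_def)
qed

lemma layer_zero_mod_mult_affines_diff_up_op_pow:
  assumes "finite V" "degree_less_mod q V (Suc a) c"
  shows "layer_zero_mod q V (a + length ts)
    (\<lambda>J. mult_affines V ts c J - (up_op ^^ length ts) c J)"
  using assms(2)
proof (induction ts arbitrary: c a)
  case Nil
  then show ?case by (simp add: layer_zero_mod_def)
next
  case (Cons t ts)
  let ?c = "mult_affine V t c" and ?m = "length ts"
  have "layer_zero_mod q V (Suc a + ?m) (\<lambda>J. mult_affines V ts ?c J - (up_op ^^ ?m) ?c J)"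
    by (intro Cons.IH degree_less_mod_mult_affine assms(1) Cons.prems)
  moreover have "layer_zero_mod q V (Suc a + ?m) (\<lambda>J. (up_op ^^ ?m) ?c J - (up_op ^^ ?m) (up_op c) J)"
    using layer_zero_mod_up_op_pow[OF assms(1)
        layer_zero_mod_mult_affine_diff_up_op[OF assms(1) Cons.prems]]
    by (simp only: up_op_pow_diff)
  ultimately have "layer_zero_mod q V (Suc a + ?m) (\<lambda>J. mult_affines V ts ?c J - (up_op ^^ ?m) (up_op c) J)"
    by (rule layer_zero_mod_diff_trans)
  then show ?case by (simp add: funpow_swap1)
qed

text \<open>Meaningful only at sets without \<open>v\<close>, where it is the cofactor of \<open>x\<^sub>v\<close> in \<open>c\<close>.\<close>

definition var_coeff :: "'a \<Rightarrow> ('a set \<Rightarrow> 'r::comm_ring_1) \<Rightarrow> 'a set \<Rightarrow> 'r" where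
  "var_coeff v c J = c (insert v J)"

lemma layer_zero_mod_insertI:
  assumes "finite W"
    and without: "layer_zero_mod q W a c"
    and var_coeff: "\<And>b. a = Suc b \<Longrightarrow> layer_zero_mod q W b (var_coeff v c)"
  shows "layer_zero_mod q (insert v W) a c"
proof (rule layer_zero_modI)
  fix J assume layer: "J \<subseteq> insert v W" "card J = a"
  show "q dvd c J"
  proof (cases "v \<in> J")
    case True
    then obtain I where remove_v: "J = insert v I" "v \<notin> I" by (rule Set.set_insert)
    then have "I \<subseteq> W" using layer(1) by auto
    moreover from this have "finite I" using \<open>finite W\<close> by (rule finite_subset)
    then have "a = Suc (card I)" using remove_v layer(2) by simp
    ultimately show ?thesis
      using layer_zero_modD[OF var_coeff] remove_v(1) by (simp add: var_coeff_def)
  next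
    case False
    then show ?thesis using layer_zero_modD[OF without] layer by auto
  qed
qed

lemma up_op_insert:
  assumes "finite J" "v \<notin> J"
  shows "up_op c (insert v J) = c J + up_op (var_coeff v c) J"
proof -
  have "insert v J - {i} = insert v (J - {i})" if "i \<in> J" for i using that assms(2) by auto
  then show ?thesis using assms by (simp add: up_op_def var_coeff_def)
qed

lemma up_op_pow_insert:
  assumes "finite J" "v \<notin> J"
  shows "(up_op ^^ Suc m) c (insert v J)
    = of_nat (Suc m) * (up_op ^^ m) c J + (up_op ^^ Suc m) (var_coeff v c) J"
  using assms
proof (induction m arbitrary: J)
  case 0
  then show ?case by (simp add: up_op_insert)
next
  case (Suc m)
  let ?c' = "var_coeff v c"
  have "(up_op ^^ Suc (Suc m)) c (insert v J)
      = (up_op ^^ Suc m) c J + up_op (var_coeff v ((up_op ^^ Suc m) c)) J"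
    using up_op_insert[OF Suc.prems, of "(up_op ^^ Suc m) c"] by simp
  also have "up_op (var_coeff v ((up_op ^^ Suc m) c)) J
      = up_op (\<lambda>I. of_nat (Suc m) * (up_op ^^ m) c I + (up_op ^^ Suc m) ?c' I) J"
    unfolding up_op_def[of _ J] var_coeff_def[of v "(up_op ^^ Suc m) c"]
    using Suc.prems by (intro sum.cong refl Suc.IH) auto
  also have "\<dots> = of_nat (Suc m) * (up_op ^^ Suc m) c J + (up_op ^^ Suc (Suc m)) ?c' J"
    by (simp add: up_op_scale_add)
  finally show ?case by (simp add: algebra_simps)
qed

lemma layer_zero_mod_up_op_pow_insertD:
  assumes "finite W" "v \<notin> W" "layer_zero_mod q (insert v W) (Suc a) ((up_op ^^ Suc m) c)"
  shows "layer_zero_mod q W a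
    (\<lambda>J. of_nat (Suc m) * (up_op ^^ m) c J + (up_op ^^ Suc m) (var_coeff v c) J)"
proof (rule layer_zero_modI)
  fix J assume layer: "J \<subseteq> W" "card J = a"
  then have fresh: "finite J" "v \<notin> J" using assms(1,2) finite_subset by auto
  then have "q dvd (up_op ^^ Suc m) c (insert v J)"
    using layer by (intro layer_zero_modD[OF assms(3)]) auto
  then show "q dvd of_nat (Suc m) * (up_op ^^ m) c J + (up_op ^^ Suc m) (var_coeff v c) J"
    unfolding up_op_pow_insert[OF fresh] .
qed

lemma layer_zero_mod_up_op_pow_var_coeff:
  assumes "finite W" "v \<notin> W" "layer_zero_mod q (insert v W) (Suc a) ((up_op ^^ Suc m) c)"
  shows "layer_zero_mod q W (Suc a) ((up_op ^^ Suc (Suc m)) (var_coeff v c))"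
proof (rule layer_zero_modI)
  fix J assume layer: "J \<subseteq> W" "card J = Suc a"
  have "layer_zero_mod q W (Suc a)
      (up_op (\<lambda>J. of_nat (Suc m) * (up_op ^^ m) c J + (up_op ^^ Suc m) (var_coeff v c) J))"
    by (intro layer_zero_mod_up_op layer_zero_mod_up_op_pow_insertD assms)
  then have "q dvd of_nat (Suc m) * (up_op ^^ Suc m) c J + (up_op ^^ Suc (Suc m)) (var_coeff v c) J"
    using layer_zero_modD[OF _ layer] by (simp only: up_op_scale_add funpow.simps o_apply)
  moreover have "q dvd (up_op ^^ Suc m) c J"
    using layer by (intro layer_zero_modD[OF assms(3)]) auto
  ultimately show "q dvd (up_op ^^ Suc (Suc m)) (var_coeff v c) J"
    by (simp only: dvd_add_right_iff dvd_mult)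
qed

text \<open>Write \<open>c = c\<^sub>0 + x\<^sub>v c\<^sub>1\<close> and \<open>e\<close> for the sum of the variables other than \<open>x\<^sub>v\<close>. The hypothesis says
  \<open>e\<^sup>m c\<^sub>0 = 0\<close> and \<open>m e\<^bsup>m-1\<^esup> c\<^sub>0 + e\<^sup>m c\<^sub>1 = 0\<close>. Multiplying the latter by \<open>e\<close> gives \<open>e\<^bsup>m+1\<^esup> c\<^sub>1 = 0\<close>,
  so \<open>c\<^sub>1 = 0\<close> by induction, and then \<open>e\<^bsup>m-1\<^esup> c\<^sub>0 = 0\<close> because \<open>m\<close> is invertible.\<close>

lemma up_op_pow_inj_mod:
  fixes q :: "'r::comm_ring_1"
  assumes "prime_elem q" "finite V" "2 * a + m \<le> card V" "\<forall>i\<in>{1..a + m}. \<not> q dvd of_nat i"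
    and "layer_zero_mod q V (a + m) ((up_op ^^ m) c)"
  shows "layer_zero_mod q V a c"
  using assms(2-)
proof (induction V arbitrary: a m c rule: finite_induct)
  case empty
  then show ?case by simp
next
  case (insert v W)
  show ?case
  proof (cases m)
    case 0
    then show ?thesis using insert.prems by simp
  next
    case (Suc k)
    let ?c' = "var_coeff v c"
    have zero: "layer_zero_mod q (insert v W) (Suc (a + k)) ((up_op ^^ Suc k) c)"
      using insert.prems(3) by (simp only: Suc add_Suc_right)
    note mixed = layer_zero_mod_up_op_pow_insertD[OF insert.hyps zero]
    have var_coeff: "layer_zero_mod q W b ?c'" if "a = Suc b" for b
      using insert.IH[of b "Suc m" ?c'] layer_zero_mod_up_op_pow_var_coeff[OF insert.hyps zero]
        insert.prems(1,2) insert.hyps that by (simp add: Suc)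
    have "layer_zero_mod q W (a + k) ((up_op ^^ Suc k) ?c')"
      using insert.hyps(1) var_coeff by (rule layer_zero_mod_up_op_pow_Suc)
    with mixed have "layer_zero_mod q W (a + k) (\<lambda>J. of_nat (Suc k) * (up_op ^^ k) c J)"
      unfolding layer_zero_mod_def by (meson dvd_add_left_iff)
    moreover have "Suc k \<in> {1..a + m}" using Suc by simp
    with insert.prems(2) have "\<not> q dvd of_nat (Suc k)" by blast
    ultimately have "layer_zero_mod q W (a + k) ((up_op ^^ k) c)"
      unfolding layer_zero_mod_def by (meson assms(1) prime_elem_dvd_mult_iff)
    then have "layer_zero_mod q W a c"
      using insert.IH[of a k c] insert.prems(1,2) insert.hyps Suc by simp
    then show ?thesis using var_coeff by (rule layer_zero_mod_insertI[OF insert.hyps(1)])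
  qed
qed

lemma degree_less_mod_lower_if_dvd_mult_affines:
  fixes q :: "'r::comm_ring_1"
  assumes "prime_elem q" "finite V"
    and degree: "degree_less_mod q V (Suc a) c" and zero: "\<And>J. J \<subseteq> V \<Longrightarrow> q dvd mult_affines V ts c J"
    and "2 * a + length ts \<le> card V" "\<forall>i\<in>{1..a + length ts}. \<not> q dvd of_nat i"
  shows "degree_less_mod q V a c"
proof (rule degree_less_mod_drop_top[OF degree])
  have "layer_zero_mod q V (a + length ts) ((up_op ^^ length ts) c)"
  proof (rule layer_zero_modI)
    fix J assume layer: "J \<subseteq> V" "card J = a + length ts"
    have "q dvd mult_affines V ts c J - (up_op ^^ length ts) c J"
      using layer_zero_mod_mult_affines_diff_up_op_pow[OF assms(2) degree] layer by (rule layer_zero_modD)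
    then show "q dvd (up_op ^^ length ts) c J"
      using zero[OF layer(1)] by (simp add: dvd_diff_right_iff)
  qed
  with assms(1,2,5,6) show "layer_zero_mod q V a c" by (rule up_op_pow_inj_mod)
qed

lemma dvd_coeff_if_dvd_mult_affines:
  fixes q :: "'r::comm_ring_1"
  assumes "prime_elem q" "finite V"
    and "degree_less_mod q V (Suc a) c" and zero: "\<And>J. J \<subseteq> V \<Longrightarrow> q dvd mult_affines V ts c J"
    and "2 * a + length ts \<le> card V" "\<forall>i\<in>{1..a + length ts}. \<not> q dvd of_nat i"
    and "J \<subseteq> V"
  shows "q dvd c J"
proof -
  have "degree_less_mod q V 0 c"
    using assms(3,5,6)
  proof (induction a)
    case 0
    show ?case by (rule degree_less_mod_lower_if_dvd_mult_affines[OF assms(1,2) 0(1) zero 0(2,3)])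
  next
    case (Suc a)
    have "degree_less_mod q V (Suc a) c"
      by (rule degree_less_mod_lower_if_dvd_mult_affines[OF assms(1,2) Suc.prems(1) zero Suc.prems(2,3)])
    then show ?case using Suc.IH Suc.prems(2,3) by simp
  qed
  then show ?thesis using \<open>J \<subseteq> V\<close> by (rule degree_less_modD) simp
qed

section \<open>Modular intersection families\<close>

lemma card_subsets_by_card:
  assumes "finite V" "finite N"
  shows "card {J. J \<subseteq> V \<and> card J \<in> N} = (\<Sum>j\<in>N. card V choose j)"
proof -
  have "{J. J \<subseteq> V \<and> card J \<in> N} = (\<Union>j\<in>N. {J. J \<subseteq> V \<and> card J = j})" by auto
  also have "card \<dots> = (\<Sum>j\<in>N. card {J. J \<subseteq> V \<and> card J = j})"
    using assms by (intro card_UN_disjoint) auto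
  finally show ?thesis using assms by (simp add: n_subsets)
qed

lemma card_Diff_singleton_Int:
  assumes "finite (A \<inter> C)" "v \<in> A \<Longrightarrow> v \<in> C"
  shows "card ((C - {v}) \<inter> A) + of_bool (v \<in> A) = card (A \<inter> C)"
proof (cases "v \<in> A")
  case True
  have "(C - {v}) \<inter> A = A \<inter> C - {v}" by auto
  then show ?thesis using True assms card_Suc_Diff1[of "A \<inter> C" v] by simp
next
  case False
  then have "(C - {v}) \<inter> A = A \<inter> C" by auto
  then show ?thesis using False by simp
qed

lemma int_dvd_diff_iff_mod_eq:
  "l < p \<Longrightarrow> int p dvd int x - int l \<longleftrightarrow> x mod p = l"
  by (metis mod_eq_dvd_iff mod_less of_nat_eq_iff of_nat_mod)

locale modular_intersection_family =
  fixes p :: nat and K L :: "nat set" and V :: "'a set" and v :: 'a and F :: "'a set set"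
  assumes prime_p: "prime p"
    and K_residues: "K \<subseteq> {0..<p}" and L_residues: "L \<subseteq> {0..<p}"
    and disjoint: "K \<inter> L = {}" and K_nonempty: "K \<noteq> {}"
    and finite_V: "finite V"
    and family: "F \<subseteq> Pow (insert v V)"
    and card_mod: "A \<in> F \<Longrightarrow> card A mod p \<in> K"
    and card_Int_mod: "A \<in> F \<Longrightarrow> B \<in> F \<Longrightarrow> A \<noteq> B \<Longrightarrow> card (A \<inter> B) mod p \<in> L"
begin

definition intersection_poly :: "'a set \<Rightarrow> 'a set \<Rightarrow> int" where
  "intersection_poly A =
    mult_affines A (map (\<lambda>l. int l - of_bool (v \<in> A)) (sorted_list_of_set L)) (monomial {})"

text \<open>The possible sizes modulo \<open>p\<close> of \<open>C - {v}\<close> with \<open>C\<close> in the family.\<close>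

definition size_roots :: "int list" where
  "size_roots = map int (sorted_list_of_set K) @ map (\<lambda>k. int k - 1) (sorted_list_of_set K)"

definition size_poly_multiple :: "'a set \<Rightarrow> 'a set \<Rightarrow> int" where
  "size_poly_multiple I = mult_affines V size_roots (monomial I)"

definition multipliers :: "'a set set" where
  "multipliers = {I. I \<subseteq> V \<and> card I + 2 * card K \<le> card L}"

definition combination :: "('a set \<Rightarrow> int) \<Rightarrow> ('a set \<Rightarrow> int) \<Rightarrow> 'a set \<Rightarrow> int" where
  "combination x y J =
    (\<Sum>A\<in>F. x A * intersection_poly A J) + (\<Sum>I\<in>multipliers. y I * size_poly_multiple I J)"

lemma finite_K: "finite K" and finite_L: "finite L" and finite_F: "finite F"
  and finite_multipliers: "finite multipliers"
  using K_residues L_residues finite_subset[OF family] finite_V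
  by (auto simp: multipliers_def intro: finite_subset)

lemma card_L_less: "card L < p"
proof -
  have "card K + card L \<le> p"
    using card_mono[of "{0..<p}" "K \<union> L"] K_residues L_residues disjoint finite_K finite_L
    by (simp add: card_Un_disjoint)
  moreover have "card K > 0" using K_nonempty finite_K by (simp add: card_gt_0_iff)
  ultimately show ?thesis by linarith
qed

lemma prime_elem_p: "prime_elem (int p)"
  using prime_p by simp

lemma length_size_roots: "length size_roots = 2 * card K"
  by (simp add: size_roots_def)

lemma finite_member: "A \<in> F \<Longrightarrow> finite A"
  using family finite_V by (auto intro: finite_subset[of _ "insert v V"])

lemma member_minus_subset: "C \<in> F \<Longrightarrow> C - {v} \<subseteq> V"
  using family by auto

lemma eval_intersection_poly:
  assumes "finite X"
  shows "multilinear_eval (intersection_poly A) X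
    = (\<Prod>l\<in>L. int (card (X \<inter> A) + of_bool (v \<in> A)) - int l)"
proof -
  have "multilinear_eval (intersection_poly A) X
      = (\<Prod>l\<leftarrow>sorted_list_of_set L. int (card (X \<inter> A) + of_bool (v \<in> A)) - int l)"
    using assms
    by (simp add: intersection_poly_def multilinear_eval_mult_affines multilinear_eval_monomial
        o_def algebra_simps)
  also have "\<dots> = (\<Prod>l\<in>L. int (card (X \<inter> A) + of_bool (v \<in> A)) - int l)"
    by (simp only: prod.distinct_set_conv_list[symmetric] distinct_sorted_list_of_set
        set_sorted_list_of_set finite_L)
  finally show ?thesis .
qed

lemma dvd_eval_intersection_poly_iff:
  assumes "A \<in> F" "C \<in> F" "v \<in> A \<Longrightarrow> v \<in> C"
  shows "int p dvd multilinear_eval (intersection_poly A) (C - {v}) \<longleftrightarrow> card (A \<inter> C) mod p \<in> L"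
proof -
  have "card ((C - {v}) \<inter> A) + of_bool (v \<in> A) = card (A \<inter> C)"
    using assms by (intro card_Diff_singleton_Int) (auto intro: finite_member)
  then have "multilinear_eval (intersection_poly A) (C - {v}) = (\<Prod>l\<in>L. int (card (A \<inter> C)) - int l)"
    using finite_member[OF assms(2)] by (simp only: eval_intersection_poly finite_Diff)
  then have "int p dvd multilinear_eval (intersection_poly A) (C - {v})
      \<longleftrightarrow> (\<exists>l\<in>L. int p dvd int (card (A \<inter> C)) - int l)"
    using finite_L prime_p by (simp add: prime_dvd_prod_iff)
  also have "\<dots> \<longleftrightarrow> (\<exists>l\<in>L. card (A \<inter> C) mod p = l)"
    using L_residues by (intro bex_cong refl int_dvd_diff_iff_mod_eq) auto
  finally show ?thesis by simp
qed

lemma dvd_eval_size_poly_multiple: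
  assumes "C \<in> F"
  shows "int p dvd multilinear_eval (size_poly_multiple I) (C - {v})"
proof -
  let ?t = "int (card C mod p) - of_bool (v \<in> C)"
  have "card (C - {v}) + of_bool (v \<in> C) = card C"
    using card_Diff_singleton_Int[of C C v] finite_member[OF assms] by (simp add: Int_absorb2)
  then have "int (card (C - {v})) - ?t = int (card C) - int (card C mod p)"
    by (cases "v \<in> C") auto
  also have "int p dvd int (card C) - int (card C mod p)"
    using prime_gt_0_nat[OF prime_p] by (simp add: int_dvd_diff_iff_mod_eq)
  finally have "int p dvd int (card (C - {v})) - ?t" .
  moreover have "?t \<in> set size_roots"
    using card_mod[OF assms] finite_K by (auto simp: size_roots_def)
  then have "int (card (C - {v})) - ?t dvd (\<Prod>t\<leftarrow>size_roots. int (card (C - {v})) - t)"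
    by (intro prod_list_dvd) (simp only: set_map imageI)
  ultimately have "int p dvd (\<Prod>t\<leftarrow>size_roots. int (card (C - {v})) - t)" by (rule dvd_trans)
  then show ?thesis
    using finite_member[OF assms] member_minus_subset[OF assms]
    by (simp add: size_poly_multiple_def multilinear_eval_mult_affines Int_absorb2)
qed

lemma degree_less_mod_intersection_poly:
  "degree_less_mod q V (Suc (card L)) (intersection_poly A)"
  using degree_less_mod_mult_affines[OF finite_V degree_less_mod_monomial[of q V "{}"],
      of "map (\<lambda>l. int l - of_bool (v \<in> A)) (sorted_list_of_set L)" A]
  by (simp add: intersection_poly_def)

lemma degree_less_mod_size_poly_multiple:
  "degree_less_mod q V (Suc (card I + 2 * card K)) (size_poly_multiple I)"
  using degree_less_mod_mult_affines[OF finite_V degree_less_mod_monomial[of q V I], of size_roots]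
  by (simp add: size_poly_multiple_def length_size_roots)

lemma combination_eq_0:
  assumes "J \<subseteq> V" "card L < card J"
  shows "combination x y J = 0"
proof -
  have "intersection_poly A J = 0" for A
    using degree_less_modD[OF degree_less_mod_intersection_poly[of 0 A], of J] assms by simp
  moreover have "size_poly_multiple I J = 0" if "I \<in> multipliers" for I
    using degree_less_modD[OF degree_less_mod_size_poly_multiple[of 0 I], of J] assms that
    by (simp add: multipliers_def)
  ultimately show ?thesis by (simp add: combination_def)
qed

lemma dvd_intersection_coeff:
  assumes zero: "\<And>J. J \<subseteq> V \<Longrightarrow> int p dvd combination x y J" and "A \<in> F"
  shows "int p dvd x A"
proof (rule triangular_system_dvd[OF prime_elem_p finite_F])
  let ?M = "\<lambda>A C. multilinear_eval (intersection_poly A) (C - {v})"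
  show "int p dvd ?M A C"
    if "A \<in> F" "C \<in> F" "A \<noteq> C" "of_bool (v \<notin> C) \<le> (of_bool (v \<notin> A) :: nat)" for A C
    using that dvd_eval_intersection_poly_iff[of A C] card_Int_mod[of A C] by (auto split: if_splits)
  show "\<not> int p dvd ?M C C" if "C \<in> F" for C
    using that dvd_eval_intersection_poly_iff[of C C] card_mod[of C] disjoint by auto
  show "int p dvd (\<Sum>A\<in>F. x A * ?M A C)" if "C \<in> F" for C
  proof -
    have "int p dvd multilinear_eval (combination x y) (C - {v})"
      unfolding multilinear_eval_def using member_minus_subset[OF that] by (intro dvd_sum zero) auto
    moreover have "int p dvd (\<Sum>I\<in>multipliers. y I * multilinear_eval (size_poly_multiple I) (C - {v}))"
      by (intro dvd_sum dvd_mult dvd_eval_size_poly_multiple that)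
    ultimately show ?thesis
      unfolding combination_def[abs_def] multilinear_eval_add multilinear_eval_sum
      by (simp only: dvd_add_left_iff)
  qed
qed (fact \<open>A \<in> F\<close>)

lemma dvd_multiplier_coeff:
  assumes size: "2 * card L \<le> card V + 2 * card K"
    and zero: "\<And>J. J \<subseteq> V \<Longrightarrow> int p dvd combination x y J" and multiplier: "I \<in> multipliers"
  shows "int p dvd y I"
proof -
  define c where "c J = (\<Sum>I\<in>multipliers. y I * monomial I J)" for J
  define a where "a = card L - 2 * card K"
  have card_L: "card L = a + 2 * card K" using multiplier by (simp add: a_def multipliers_def)
  have c_eq: "c J = (if J \<in> multipliers then y J else 0)" for J
    using finite_multipliers by (simp add: c_def monomial_def of_bool_def if_distrib cong: if_cong)
  have "int p dvd c I"
  proof (rule dvd_coeff_if_dvd_mult_affines[OF prime_elem_p finite_V])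
    show "degree_less_mod (int p) V (Suc a) c"
      by (auto simp: degree_less_mod_def c_eq multipliers_def card_L)
    show "2 * a + length size_roots \<le> card V"
      using size by (simp add: length_size_roots card_L)
    show "\<forall>i\<in>{1..a + length size_roots}. \<not> int p dvd int i"
      using card_L_less by (auto simp: length_size_roots card_L dest: dvd_imp_le)
    show "I \<subseteq> V" using multiplier by (simp add: multipliers_def)
    fix J assume "J \<subseteq> V"
    have "int p dvd (\<Sum>A\<in>F. x A * intersection_poly A J)"
      by (intro dvd_sum dvd_mult2 dvd_intersection_coeff[OF zero])
    then have "int p dvd (\<Sum>I\<in>multipliers. y I * size_poly_multiple I J)"
      using zero[OF \<open>J \<subseteq> V\<close>] by (simp add: combination_def dvd_add_right_iff)
    then show "int p dvd mult_affines V size_roots c J"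
      by (simp add: c_def[abs_def] mult_affines_sum size_poly_multiple_def)
  qed
  then show ?thesis using multiplier by (simp add: c_eq)
qed

lemma card_family_add_card_multipliers_le:
  assumes "2 * card L \<le> card V + 2 * card K"
  shows "card F + card multipliers \<le> card {J. J \<subseteq> V \<and> card J \<le> card L}"
proof -
  let ?B = "{J. J \<subseteq> V \<and> card J \<le> card L}"
  have "card (F <+> multipliers) \<le> card ?B"
  proof (rule card_le_if_independent_mod)
    show "p > 1" using prime_p by (rule prime_gt_1_nat)
    show "finite (F <+> multipliers)" "finite ?B"
      using finite_F finite_multipliers finite_V by auto
    fix z e
    assume zero: "\<forall>J\<in>?B. int p dvd
        (\<Sum>e\<in>F <+> multipliers. z e * case_sum intersection_poly size_poly_multiple e J)"
      and index: "e \<in> F <+> multipliers"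
    have "int p dvd combination (z \<circ> Inl) (z \<circ> Inr) J" if "J \<subseteq> V" for J
      using zero that combination_eq_0[OF that, of "z \<circ> Inl" "z \<circ> Inr"] finite_F finite_multipliers
      by (cases "card J \<le> card L") (auto simp: combination_def sum.Plus)
    then show "int p dvd z e"
      using index dvd_intersection_coeff[of "z \<circ> Inl" "z \<circ> Inr"]
        dvd_multiplier_coeff[OF assms, of "z \<circ> Inl" "z \<circ> Inr"] by auto
  qed
  then show ?thesis using finite_F finite_multipliers by (simp add: card_Plus)
qed

theorem card_family_le:
  assumes "2 * card L \<le> card V + 2 * card K"
  shows "card F \<le> (\<Sum>j | j \<le> card L \<and> card L < j + 2 * card K. card V choose j)"
proof -
  let ?B = "{J. J \<subseteq> V \<and> card J \<le> card L}" and ?N = "{j. j \<le> card L \<and> card L < j + 2 * card K}"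
  have "multipliers \<subseteq> ?B" by (auto simp: multipliers_def)
  then have "card (?B - multipliers) = card ?B - card multipliers"
    using finite_multipliers by (intro card_Diff_subset)
  then have "card F \<le> card (?B - multipliers)"
    using card_family_add_card_multipliers_le[OF assms] by simp
  also have "?B - multipliers = {J. J \<subseteq> V \<and> card J \<in> ?N}" by (auto simp: multipliers_def)
  also have "card \<dots> = (\<Sum>j\<in>?N. card V choose j)"
    using finite_V by (intro card_subsets_by_card) auto
  finally show ?thesis .
qed

end

lemma sum_ibinom:
  "(\<Sum>i<m. ibinom N (int s - int i)) = (\<Sum>j | j \<le> s \<and> s < j + m. N choose j)"
proof -
  have "(\<Sum>i<m. ibinom N (int s - int i)) = (\<Sum>i | i < m \<and> i \<le> s. ibinom N (int s - int i))"
    by (rule sum.mono_neutral_right) (auto simp: ibinom_def)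
  also have "\<dots> = (\<Sum>j | j \<le> s \<and> s < j + m. N choose j)"
    by (rule sum.reindex_bij_witness[where i = "\<lambda>j. s - j" and j = "\<lambda>i. s - i"])
       (auto simp: ibinom_def nat_diff_distrib)
  finally show ?thesis .
qed

theorem theorem2p11:
  fixes p n :: nat and K L :: "nat set" and F :: "nat set set"
  assumes "prime p"
    and "K \<subseteq> {0..<p}" and "L \<subseteq> {0..<p}" and "K \<inter> L = {}" and "card K \<ge> 1"
    and "F \<subseteq> Pow {1..n}"
    and "\<forall>A\<in>F. card A mod p \<in> K"
    and "\<forall>A\<in>F. \<forall>B\<in>F. A \<noteq> B \<longrightarrow> card (A \<inter> B) mod p \<in> L"
    and "int n \<ge> 2 * int (card L) - 2 * int (card K) + 1"
  shows "card F \<le> (\<Sum>i<2 * card K. ibinom (n - 1) (int (card L) - int i))"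
proof -
  interpret modular_intersection_family p K L "{1..<n}" n F
  proof
    show "K \<noteq> {}" using assms(5) by auto
    show "F \<subseteq> Pow (insert n {1..<n})" using assms(6) by force
  qed (use assms in auto)
  have "2 * card L \<le> card {1..<n} + 2 * card K" using assms(9) by simp
  from card_family_le[OF this] show ?thesis by (simp add: sum_ibinom)
qed

end
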